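(* Let $q$ be a prime power, $k$ a positive integer, let $U$ be an $\mathbb{F}_q$-subspace of $\mathbb{F}_{q^k}^2$, and let $\gamma$ be a root of an irreducible polynomial over $\mathbb{F}_{q^k}$ of degree greater than two. Then $U$ has the Sidon space property with respect to $\gamma$ if and only if $$S_{(u,v)}\cap S_{(u',v')}=\mathbb{F}_q$$ for any $\mathbb{F}_q$-linearly independent $(u,v),(u',v')\in U$, where $S_{(u,v)}=\{\lambda\in\mathbb{F}_{q^k} : \lambda(u,v)\in U\}$.
   Context: Let $V_{U,\gamma}=\{u+v\gamma : (u,v)\in U\}\subseteq\mathbb{F}_{q^k}(\gamma)$. For $(u,v)\in U$ put $S^{\gamma}_{(u,v)}=\{\lambda\in\mathbb{F}_{q^k}(\gamma) : \lambda(u+v\gamma)\in V_{U,\gamma}\}$. The subspace $U$ has the Sidon space property with respect to $\gamma$ if for every $\mathbb{F}_q$-linearly independent $(u,v),(u',v')\in U$ one has $S^{\gamma}_{(u,v)}\cap S^{\gamma}_{(u',v')}=\mathbb{F}_q$. *)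

theory Defs
  imports
    "HOL-Algebra.Finite_Extensions"
    "HOL-Algebra.Generated_Fields"
    "HOL-Number_Theory.Prime_Powers"
    "Jordan_Normal_Form.Missing_VectorSpace"
begin

text \<open>
  All fields live inside one ambient field \<open>L\<close>. The field of order \<open>q\<close> is a subfield \<open>F\<close> of \<open>L\<close>,
  the field of order \<open>q ^ k\<close> is a subfield \<open>K\<close> of \<open>L\<close> with \<open>F \<subseteq> K\<close>, and the extension \<open>K(\<gamma>)\<close>
  is \<open>generate_field L (insert \<gamma> K)\<close>.
\<close>

text \<open>The components \<open>mult\<close> and \<open>one\<close> of a module record are irrelevant to the module structure.
  The scalars are not part of the record: \<open>K\<close> becomes an \<open>F\<close>-vector space in
  \<open>vectorspace (L\<lparr>carrier := F\<rparr>) (self_module L K)\<close>.\<close>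

definition self_module :: "('a, 'b) ring_scheme \<Rightarrow> 'a set \<Rightarrow> ('a, 'a) module" where
  "self_module L K =
     \<lparr>carrier = K, mult = mult L, one = one L, zero = zero L, add = add L, smult = mult L\<rparr>"

definition plane :: "('a, 'b) ring_scheme \<Rightarrow> 'a set \<Rightarrow> ('a, 'a \<times> 'a) module" where
  "plane L K = direct_sum (self_module L K) (self_module L K)"

text \<open>Independence of a pair is that of the family \<open>w, w'\<close>: since \<open>lin_indpt\<close> speaks about sets,
  \<open>w \<noteq> w'\<close> has to be required separately.\<close>

definition lin_indpt_pair ::
    "('a, 'b) ring_scheme \<Rightarrow> 'a set \<Rightarrow> 'a set \<Rightarrow> 'a \<times> 'a \<Rightarrow> 'a \<times> 'a \<Rightarrow> bool" where
  "lin_indpt_pair L F K w w' \<longleftrightarrow>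
     w \<noteq> w' \<and> module.lin_indpt (L\<lparr>carrier := F\<rparr>) (plane L K) {w, w'}"

definition V_gamma :: "('a, 'b) ring_scheme \<Rightarrow> ('a \<times> 'a) set \<Rightarrow> 'a \<Rightarrow> 'a set" where
  "V_gamma L U \<gamma> = {u \<oplus>\<^bsub>L\<^esub> v \<otimes>\<^bsub>L\<^esub> \<gamma> | u v. (u, v) \<in> U}"

definition S_gamma ::
    "('a, 'b) ring_scheme \<Rightarrow> 'a set \<Rightarrow> ('a \<times> 'a) set \<Rightarrow> 'a \<Rightarrow> 'a \<times> 'a \<Rightarrow> 'a set" where
  "S_gamma L K U \<gamma> = (\<lambda>(u, v).
     {\<mu> \<in> generate_field L (insert \<gamma> K). \<mu> \<otimes>\<^bsub>L\<^esub> (u \<oplus>\<^bsub>L\<^esub> v \<otimes>\<^bsub>L\<^esub> \<gamma>) \<in> V_gamma L U \<gamma>})"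

definition Sidon_space_property ::
    "('a, 'b) ring_scheme \<Rightarrow> 'a set \<Rightarrow> 'a set \<Rightarrow> ('a \<times> 'a) set \<Rightarrow> 'a \<Rightarrow> bool" where
  "Sidon_space_property L F K U \<gamma> \<longleftrightarrow>
     (\<forall>w\<in>U. \<forall>w'\<in>U. lin_indpt_pair L F K w w' \<longrightarrow> S_gamma L K U \<gamma> w \<inter> S_gamma L K U \<gamma> w' = F)"

definition S_plain ::
    "('a, 'b) ring_scheme \<Rightarrow> 'a set \<Rightarrow> ('a \<times> 'a) set \<Rightarrow> 'a \<times> 'a \<Rightarrow> 'a set" where
  "S_plain L K U = (\<lambda>(u, v). {\<mu> \<in> K. (\<mu> \<otimes>\<^bsub>L\<^esub> u, \<mu> \<otimes>\<^bsub>L\<^esub> v) \<in> U})"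

end

theory Submission
  imports Defs
begin

text \<open>
  Since \<open>1, \<gamma>, \<gamma>\<^sup>2\<close> are independent over \<open>K\<close>, one has \<open>S = S\<^sup>\<gamma> \<inter> K\<close>. Hence only elements \<open>\<mu> \<notin> K\<close> of
  \<open>S\<^sup>\<gamma>\<^bsub>(u,v)\<^esub> \<inter> S\<^sup>\<gamma>\<^bsub>(u',v')\<^esub>\<close> matter. Put \<open>\<mu> (u + v \<gamma>) = a + b \<gamma>\<close> and \<open>\<mu> (u' + v' \<gamma>) = c + d \<gamma>\<close>; then
  \<open>(a + b X) (u' + v' X) = (c + d X) (u + v X)\<close> holds in \<open>K[X]\<close>. If \<open>(u, v)\<close> and \<open>(u', v')\<close> are independent
  over \<open>K\<close>, then \<open>u + v X\<close> divides \<open>a + b X\<close> and so \<open>\<mu> \<in> K\<close>. Otherwise \<open>(u', v') = m (u, v)\<close> with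
  \<open>m \<in> K - F\<close>, so \<open>(c, d) = m (a, b)\<close>, and \<open>m \<in> S\<^bsub>(u,v)\<^esub> \<inter> S\<^bsub>(a,b)\<^esub>\<close>; the condition over \<open>K\<close> makes \<open>(a, b)\<close> and
  \<open>(u, v)\<close> dependent over \<open>F\<close>, that is, \<open>\<mu> \<in> F\<close>.
\<close>

section \<open>Powers of a root of an irreducible polynomial\<close>

text \<open>The polynomials over \<open>K\<close> vanishing at \<open>x\<close> form the ideal
  generated by \<open>Irr K x\<close>. An irreducible \<open>f\<close> in this ideal is associated
  to the generator, hence divides every other member.\<close>

lemma (in domain) degree_pirreducible_root_le:
  assumes K: "subfield K R" and x: "x \<in> carrier R"
    and f: "f \<in> carrier (K[X])" "pirreducible K f" "eval f x = \<zero>"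
    and p: "p \<in> carrier (K[X])" "p \<noteq> []" "eval p x = \<zero>"
  shows "degree f \<le> degree p"
proof -
  have subring: "subring K R" using subfieldE(1)[OF K] .
  interpret UP: principal_domain "K[X]" using univ_poly_is_principal[OF K] .
  have alg: "(algebraic over K) x" using algebraicI p by blast
  note Irr = IrrE[OF K x alg]
  have "f \<in> PIdl\<^bsub>K[X]\<^esub> (Irr K x)"
    using Irr_generates_ker[OF K x alg] f(1,3) unfolding a_kernel_def' by auto
  then have "f \<sim>\<^bsub>K[X]\<^esub> Irr K x"
    using cgenideal_pirreducible[OF K Irr(1,2) f(2)] Irr(1) f(1) UP.associated_sym by blast
  moreover have "Irr K x divides\<^bsub>K[X]\<^esub> p"
    using Irr_minimal[OF K x alg p(1,3)] pdivides_iff_shell[OF K Irr(1) p(1)] by simp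
  ultimately have "f divides\<^bsub>K[X]\<^esub> p"
    using f(1) UP.divides_trans unfolding associated_def by blast
  then show ?thesis
    using pdivides_imp_degree_le[OF subring f(1) p(1,2)] pdivides_iff_shell[OF K f(1) p(1)] by simp
qed

lemma (in domain) quadratic_independent:
  assumes K: "subfield K R" and x: "x \<in> carrier R"
    and f: "f \<in> carrier (K[X])" "pirreducible K f" "eval f x = \<zero>" "degree f > 2"
    and abc: "a \<in> K" "b \<in> K" "c \<in> K" and eq: "a \<oplus> b \<otimes> x \<oplus> c \<otimes> (x \<otimes> x) = \<zero>"
  shows "a = \<zero> \<and> b = \<zero> \<and> c = \<zero>"
proof -
  \<comment> \<open>Coefficients are listed from the top degree down, and elements of
    \<open>K[X]\<close> have no leading zeros, so \<open>c\<close> and \<open>b\<close> may have to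
    be stripped.\<close>
  let ?p = "normalize [c, b, a]"
  have carr: "a \<in> carrier R" "b \<in> carrier R" "c \<in> carrier R"
    using abc subfieldE(3)[OF K] by auto
  have "eval ?p x = eval [c, b, a] x"
    using eval_normalize[of "[c, b, a]" x] carr x by simp
  also have "\<dots> = a \<oplus> b \<otimes> x \<oplus> c \<otimes> (x \<otimes> x)"
    using carr x by (simp add: numeral_2_eq_2 nat_pow_def) algebra
  finally have root: "eval ?p x = \<zero>" using eq by simp
  have p: "?p \<in> carrier (K[X])"
    unfolding univ_poly_carrier[symmetric] by (rule normalize_gives_polynomial) (use abc in simp)
  have "degree ?p \<le> 2" using normalize_length_le[of "[c, b, a]"] by simp
  then have "?p = []"
    using degree_pirreducible_root_le[OF K x f(1-3) p _ root] f(4) by linarith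
  then show ?thesis by (auto split: if_splits)
qed

text \<open>For nonzero \<open>v\<close> the set \<open>{v}\<close> is independent, and adjoining
  \<open>w\<close> keeps it so exactly when \<open>w\<close> lies outside the line spanned by
  \<open>v\<close>. The asymmetric form delivers an explicit scalar when independence fails.\<close>

lemma (in vectorspace) lin_indpt_doubleton_iff:
  assumes "v \<in> carrier V" "w \<in> carrier V"
  shows "v \<noteq> w \<and> lin_indpt {v, w} \<longleftrightarrow> v \<noteq> \<zero>\<^bsub>V\<^esub> \<and> w \<notin> (\<lambda>c. c \<odot>\<^bsub>V\<^esub> v) ` carrier K"
proof (cases "v = \<zero>\<^bsub>V\<^esub>")
  case True
  then show ?thesis using vs_zero_lin_dep[of "{v, w}"] assms by auto
next
  case False
  have lincomb: "lincomb a {v} = a v \<odot>\<^bsub>V\<^esub> v" if "a v \<in> carrier K" for a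
    using that assms unfolding lincomb_def by simp
  have span: "span {v} = (\<lambda>c. c \<odot>\<^bsub>V\<^esub> v) ` carrier K"
  proof -
    have "span {v} = {lincomb a {v} | a. a \<in> {v} \<rightarrow> carrier K}"
      using finite_span[of "{v}"] assms by auto
    also have "\<dots> = (\<lambda>c. c \<odot>\<^bsub>V\<^esub> v) ` carrier K"
    proof (intro equalityI subsetI)
      fix y assume "y \<in> (\<lambda>c. c \<odot>\<^bsub>V\<^esub> v) ` carrier K"
      then obtain c where "c \<in> carrier K" "y = c \<odot>\<^bsub>V\<^esub> v" by blast
      then show "y \<in> {lincomb a {v} | a. a \<in> {v} \<rightarrow> carrier K}"
        using lincomb[of "\<lambda>_. c"] by (intro CollectI exI[of _ "\<lambda>_. c"]) auto
    qed (use lincomb in fastforce)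
    finally show ?thesis .
  qed
  have indpt: "lin_indpt {v}"
  proof (rule finite_lin_indpt2)
    fix a assume a: "a \<in> {v} \<rightarrow> carrier K" "lincomb a {v} = \<zero>\<^bsub>V\<^esub>"
    then have "a v \<odot>\<^bsub>V\<^esub> v = \<zero>\<^bsub>V\<^esub>" using lincomb by auto
    have "v = \<zero>\<^bsub>V\<^esub>" if nz: "a v \<noteq> \<zero>\<^bsub>K\<^esub>"
    proof -
      have unit: "a v \<in> Units K" using a(1) nz field_Units by auto
      have "v = (inv\<^bsub>K\<^esub> a v \<otimes>\<^bsub>K\<^esub> a v) \<odot>\<^bsub>V\<^esub> v"
        using Units_l_inv[OF unit] assms by simp
      also have "\<dots> = inv\<^bsub>K\<^esub> a v \<odot>\<^bsub>V\<^esub> (a v \<odot>\<^bsub>V\<^esub> v)"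
        using unit assms by (intro smult_assoc1) auto
      also have "\<dots> = \<zero>\<^bsub>V\<^esub>"
        using \<open>a v \<odot>\<^bsub>V\<^esub> v = \<zero>\<^bsub>V\<^esub>\<close> unit by simp
      finally show ?thesis .
    qed
    then show "\<forall>w\<in>{v}. a w = \<zero>\<^bsub>K\<^esub>" using False by auto
  qed (use assms in auto)
  \<comment> \<open>Settles the case \<open>w = v\<close>, where both sides are false.\<close>
  have "v \<in> span {v}"
    unfolding span using assms by (auto intro!: image_eqI[of _ _ "\<one>\<^bsub>K\<^esub>"])
  moreover have "w \<in> span {v} \<longleftrightarrow> lin_dep {v, w}" if "v \<noteq> w"
    using lin_dep_iff_in_span[of "{v}" w] indpt assms that by (auto simp: insert_commute)
  ultimately show ?thesis using False span by blast
qed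

text \<open>Multiplying out \<open>(a + b X) (u' + v' X) = (c + d X) (u + v X)\<close> and substituting \<open>X = - u / v\<close>
  (after clearing denominators) kills the right-hand side.\<close>

lemma (in domain) linear_forms_proportional:
  assumes carr: "a \<in> carrier R" "b \<in> carrier R" "c \<in> carrier R" "d \<in> carrier R"
      "u \<in> carrier R" "v \<in> carrier R" "u' \<in> carrier R" "v' \<in> carrier R"
    and eqs: "a \<otimes> u' = c \<otimes> u" "a \<otimes> v' \<oplus> b \<otimes> u' = c \<otimes> v \<oplus> d \<otimes> u" "b \<otimes> v' = d \<otimes> v"
    and "u \<otimes> v' \<noteq> v \<otimes> u'"
  shows "a \<otimes> v = b \<otimes> u"
proof -
  have "(a \<otimes> v \<ominus> b \<otimes> u) \<otimes> (v \<otimes> u' \<ominus> u \<otimes> v')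
      = (a \<otimes> u') \<otimes> (v \<otimes> v) \<ominus> (a \<otimes> v' \<oplus> b \<otimes> u') \<otimes> (u \<otimes> v) \<oplus> (b \<otimes> v') \<otimes> (u \<otimes> u)"
    using carr by algebra
  also have "\<dots> = \<zero>"
    unfolding eqs using carr by algebra
  finally have "a \<otimes> v \<ominus> b \<otimes> u = \<zero> \<or> v \<otimes> u' \<ominus> u \<otimes> v' = \<zero>"
    using carr integral_iff by simp
  then show ?thesis
    using carr assms(12) by (metis m_closed r_right_minus_eq)
qed

section \<open>Linear and quadratic expressions in the generator\<close>

text \<open>The degree condition enters as independence of 1, \<open>\<gamma>\<close> and its square
  over \<open>K\<close>: enough to compare coefficients in products of two linear forms.\<close>

locale degree_gt_two_generator = field L for L (structure) +
  fixes F K :: "'a set" and U :: "('a \<times> 'a) set" and \<gamma> :: 'a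
  assumes subfield_K: "subfield K L"
    and F_subset_K: "F \<subseteq> K"
    and subspace_U: "subspace (L\<lparr>carrier := F\<rparr>) U (plane L K)"
    and \<gamma>_closed: "\<gamma> \<in> carrier L"
    and independent_\<gamma>: "\<lbrakk>a \<in> K; b \<in> K; c \<in> K; a \<oplus> b \<otimes> \<gamma> \<oplus> c \<otimes> (\<gamma> \<otimes> \<gamma>) = \<zero>\<rbrakk>
          \<Longrightarrow> a = \<zero> \<and> b = \<zero> \<and> c = \<zero>"
begin

lemma K_closed: "x \<in> K \<Longrightarrow> x \<in> carrier L"
  using subfieldE(3)[OF subfield_K] by blast

lemmas subring_K = subfieldE(1)[OF subfield_K]

lemma K_minus: "\<lbrakk>x \<in> K; y \<in> K\<rbrakk> \<Longrightarrow> x \<ominus> y \<in> K"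
  using subringE(5,7)[OF subring_K] by (simp add: a_minus_def)

lemma U_closed:
  assumes "(u, v) \<in> U" shows "u \<in> K" "v \<in> K"
  using assms submodule.subset[OF subspace.submod[OF subspace_U]]
  by (auto simp: plane_def direct_sum_def self_module_def)

lemma lin_indpt_pair_iff:
  assumes "u \<in> K" "v \<in> K" "u' \<in> K" "v' \<in> K"
  shows "lin_indpt_pair L F K (u, v) (u', v') \<longleftrightarrow>
    (u, v) \<noteq> (\<zero>, \<zero>) \<and> (\<forall>c\<in>F. (u', v') \<noteq> (c \<otimes> u, c \<otimes> v))"
  \<comment> \<open>That the plane is an \<open>F\<close>-vector space is part of
    \<open>subspace_U\<close>.\<close>
  using vectorspace.lin_indpt_doubleton_iff[OF subspace.vs[OF subspace_U], of "(u, v)" "(u', v')"] assms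
  unfolding lin_indpt_pair_def
  by (auto simp: plane_def direct_sum_def self_module_def)

lemma quadratic_eq_iff:
  assumes "a \<in> K" "b \<in> K" "c \<in> K" "a' \<in> K" "b' \<in> K" "c' \<in> K"
  shows "a \<oplus> b \<otimes> \<gamma> \<oplus> c \<otimes> (\<gamma> \<otimes> \<gamma>) = a' \<oplus> b' \<otimes> \<gamma> \<oplus> c' \<otimes> (\<gamma> \<otimes> \<gamma>)
    \<longleftrightarrow> a = a' \<and> b = b' \<and> c = c'"
proof
  assume eq: "a \<oplus> b \<otimes> \<gamma> \<oplus> c \<otimes> (\<gamma> \<otimes> \<gamma>) = a' \<oplus> b' \<otimes> \<gamma> \<oplus> c' \<otimes> (\<gamma> \<otimes> \<gamma>)"
  have carr: "a \<in> carrier L" "b \<in> carrier L" "c \<in> carrier L"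
      "a' \<in> carrier L" "b' \<in> carrier L" "c' \<in> carrier L"
    using assms K_closed by auto
  have "(a \<ominus> a') \<oplus> (b \<ominus> b') \<otimes> \<gamma> \<oplus> (c \<ominus> c') \<otimes> (\<gamma> \<otimes> \<gamma>)
      = (a \<oplus> b \<otimes> \<gamma> \<oplus> c \<otimes> (\<gamma> \<otimes> \<gamma>)) \<ominus> (a' \<oplus> b' \<otimes> \<gamma> \<oplus> c' \<otimes> (\<gamma> \<otimes> \<gamma>))"
    using carr \<gamma>_closed by algebra
  also have "\<dots> = \<zero>"
    unfolding eq using carr \<gamma>_closed by algebra
  finally have "a \<ominus> a' = \<zero> \<and> b \<ominus> b' = \<zero> \<and> c \<ominus> c' = \<zero>"
    by (intro independent_\<gamma> K_minus assms)
  then show "a = a' \<and> b = b' \<and> c = c'"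
    using carr by simp
qed simp

lemma linear_eq_iff:
  assumes "a \<in> K" "b \<in> K" "a' \<in> K" "b' \<in> K"
  shows "a \<oplus> b \<otimes> \<gamma> = a' \<oplus> b' \<otimes> \<gamma> \<longleftrightarrow> a = a' \<and> b = b'"
  using quadratic_eq_iff[of a b \<zero> a' b' \<zero>] assms assms[THEN K_closed] subringE(2)[OF subring_K] \<gamma>_closed
  by simp

lemma linear_nonzero:
  assumes "u \<in> K" "v \<in> K" "(u, v) \<noteq> (\<zero>, \<zero>)"
  shows "u \<oplus> v \<otimes> \<gamma> \<noteq> \<zero>"
proof -
  have "\<zero> \<in> K" using subringE(2)[OF subring_K] .
  from linear_eq_iff[OF assms(1,2) this this] show ?thesis using assms(3) \<gamma>_closed by simp
qed

lemma smult_linear: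
  assumes "m \<in> K" "u \<in> K" "v \<in> K"
  shows "m \<otimes> (u \<oplus> v \<otimes> \<gamma>) = m \<otimes> u \<oplus> (m \<otimes> v) \<otimes> \<gamma>"
  using assms[THEN K_closed] \<gamma>_closed by algebra

lemma generate_field_closed: "\<mu> \<in> generate_field L (insert \<gamma> K) \<Longrightarrow> \<mu> \<in> carrier L"
  by (rule generate_field_in_carrier[of "insert \<gamma> K"]) (auto simp: \<gamma>_closed K_closed)

lemma S_gammaE:
  assumes "\<mu> \<in> S_gamma L K U \<gamma> (u, v)"
  obtains a b where "(a, b) \<in> U" "a \<in> K" "b \<in> K" "\<mu> \<in> carrier L"
    "\<mu> \<otimes> (u \<oplus> v \<otimes> \<gamma>) = a \<oplus> b \<otimes> \<gamma>"
proof -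
  from assms obtain a b where "(a, b) \<in> U" "\<mu> \<in> generate_field L (insert \<gamma> K)"
      "\<mu> \<otimes> (u \<oplus> v \<otimes> \<gamma>) = a \<oplus> b \<otimes> \<gamma>"
    unfolding S_gamma_def V_gamma_def by blast
  then show thesis using that U_closed generate_field_closed by blast
qed

text \<open>For \<open>\<mu>\<close> in \<open>K\<close> the product with
  \<open>u + v \<gamma>\<close> has coordinates \<open>(\<mu> u, \<mu> v)\<close>; since coordinates
  are unique, it lies in \<open>V_gamma\<close> only if this very pair lies in
  \<open>U\<close>.\<close>

lemma S_plain_eq:
  assumes "(u, v) \<in> U"
  shows "S_plain L K U (u, v) = S_gamma L K U \<gamma> (u, v) \<inter> K"
proof -
  have "(\<mu> \<otimes> u, \<mu> \<otimes> v) \<in> U \<longleftrightarrow> \<mu> \<otimes> (u \<oplus> v \<otimes> \<gamma>) \<in> V_gamma L U \<gamma>" if \<mu>: "\<mu> \<in> K" for \<mu>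
  proof -
    note uv = U_closed[OF assms]
    have K: "\<mu> \<otimes> u \<in> K" "\<mu> \<otimes> v \<in> K" using subringE(6)[OF subring_K] \<mu> uv by auto
    show ?thesis
      unfolding smult_linear[OF \<mu> uv] V_gamma_def
      using linear_eq_iff[OF K] U_closed by blast
  qed
  moreover have "\<mu> \<in> generate_field L (insert \<gamma> K)" if "\<mu> \<in> K" for \<mu>
    using that by (auto intro: generate_field.incl)
  ultimately show ?thesis unfolding S_plain_def S_gamma_def by auto
qed

text \<open>Cancels the nonzero factor \<open>u + v \<gamma>\<close>. This is how a multiplier from
  the large field is identified with a scalar of \<open>K\<close>.\<close>

lemma eq_scalar:
  assumes "m \<in> K" "u \<in> K" "v \<in> K" "(u, v) \<noteq> (\<zero>, \<zero>)" "\<mu> \<in> carrier L"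
    and "\<mu> \<otimes> (u \<oplus> v \<otimes> \<gamma>) = m \<otimes> u \<oplus> (m \<otimes> v) \<otimes> \<gamma>"
  shows "\<mu> = m"
proof -
  have "\<mu> \<otimes> (u \<oplus> v \<otimes> \<gamma>) = m \<otimes> (u \<oplus> v \<otimes> \<gamma>)" using smult_linear assms by simp
  then show ?thesis
    using m_rcancel[of "u \<oplus> v \<otimes> \<gamma>"] linear_nonzero assms \<gamma>_closed K_closed by simp
qed

text \<open>The ratio is \<open>a / u\<close>, or \<open>b / v\<close> when \<open>u\<close>
  vanishes; in the latter case the cross equation forces \<open>a\<close> to vanish too.\<close>

lemma proportional_pair:
  assumes K: "u \<in> K" "v \<in> K" "a \<in> K" "b \<in> K"
    and nz: "(u, v) \<noteq> (\<zero>, \<zero>)" and cross: "a \<otimes> v = b \<otimes> u"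
  obtains m where "m \<in> K" "a = m \<otimes> u" "b = m \<otimes> v"
proof (cases "u = \<zero>")
  case False
  then have inv: "inv u \<in> K" "u \<otimes> inv u = \<one>" using subfield_m_inv[OF subfield_K] K(1) by auto
  note carr = K[THEN K_closed] inv(1)[THEN K_closed]
  have "a = a \<otimes> (u \<otimes> inv u)" "b = b \<otimes> (u \<otimes> inv u)" using inv(2) carr by simp_all
  moreover have "a \<otimes> (u \<otimes> inv u) = (a \<otimes> inv u) \<otimes> u" using carr by algebra
  moreover have "b \<otimes> (u \<otimes> inv u) = (b \<otimes> u) \<otimes> inv u" using carr by algebra
  moreover have "(a \<otimes> v) \<otimes> inv u = (a \<otimes> inv u) \<otimes> v" using carr by algebra
  ultimately show thesis
    using that[of "a \<otimes> inv u"] subringE(6)[OF subring_K] K inv(1) cross by metis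
next
  case True
  then have v: "v \<noteq> \<zero>" using nz by simp
  then have inv: "inv v \<in> K" "v \<otimes> inv v = \<one>" using subfield_m_inv[OF subfield_K] K(2) by auto
  note carr = K[THEN K_closed] inv(1)[THEN K_closed]
  have "a = \<zero>" using cross True v carr integral_iff by simp
  moreover have "b = b \<otimes> (v \<otimes> inv v)" using inv(2) carr by simp
  moreover have "b \<otimes> (v \<otimes> inv v) = (b \<otimes> inv v) \<otimes> v" using carr by algebra
  ultimately show thesis
    using that[of "b \<otimes> inv v"] subringE(6)[OF subring_K] K inv(1) carr True by simp
qed

section \<open>Multipliers shared by two vectors of \<open>U\<close>\<close>

text \<open>The case of independence over \<open>K\<close>, expressed by a nonzero
  determinant.\<close>

lemma S_gamma_inter_subset_K:
  assumes w: "(u, v) \<in> U" "(u', v') \<in> U" and det: "u \<otimes> v' \<noteq> v \<otimes> u'"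
  shows "S_gamma L K U \<gamma> (u, v) \<inter> S_gamma L K U \<gamma> (u', v') \<subseteq> K"
proof
  fix \<mu> assume "\<mu> \<in> S_gamma L K U \<gamma> (u, v) \<inter> S_gamma L K U \<gamma> (u', v')"
  then obtain a b c d where K: "a \<in> K" "b \<in> K" "c \<in> K" "d \<in> K" and \<mu>: "\<mu> \<in> carrier L"
    and ab: "\<mu> \<otimes> (u \<oplus> v \<otimes> \<gamma>) = a \<oplus> b \<otimes> \<gamma>"
    and cd: "\<mu> \<otimes> (u' \<oplus> v' \<otimes> \<gamma>) = c \<oplus> d \<otimes> \<gamma>"
    by (elim IntE S_gammaE)
  note KU = U_closed[OF w(1)] U_closed[OF w(2)]
  note carr = K[THEN K_closed] KU[THEN K_closed]
  \<comment> \<open>Both ends of this chain expand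
    \<open>\<mu> (u + v \<gamma>) (u' + v' \<gamma>)\<close>, with \<open>\<mu>\<close> absorbed
    into one factor or the other.\<close>
  have "a \<otimes> u' \<oplus> (a \<otimes> v' \<oplus> b \<otimes> u') \<otimes> \<gamma> \<oplus> (b \<otimes> v') \<otimes> (\<gamma> \<otimes> \<gamma>) = (a \<oplus> b \<otimes> \<gamma>) \<otimes> (u' \<oplus> v' \<otimes> \<gamma>)"
    using carr \<gamma>_closed by algebra
  also have "\<dots> = (\<mu> \<otimes> (u' \<oplus> v' \<otimes> \<gamma>)) \<otimes> (u \<oplus> v \<otimes> \<gamma>)"
    unfolding ab[symmetric] using carr \<mu> \<gamma>_closed by algebra
  also have "\<dots> = c \<otimes> u \<oplus> (c \<otimes> v \<oplus> d \<otimes> u) \<otimes> \<gamma> \<oplus> (d \<otimes> v) \<otimes> (\<gamma> \<otimes> \<gamma>)"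
    unfolding cd using carr \<gamma>_closed by algebra
  finally have "a \<otimes> u' = c \<otimes> u \<and> a \<otimes> v' \<oplus> b \<otimes> u' = c \<otimes> v \<oplus> d \<otimes> u \<and> b \<otimes> v' = d \<otimes> v"
    using K KU subringE(6,7)[OF subring_K]
    by (subst (asm) quadratic_eq_iff) auto
  then have "a \<otimes> v = b \<otimes> u"
    using linear_forms_proportional[OF carr] det by blast
  moreover have nz: "(u, v) \<noteq> (\<zero>, \<zero>)" using det carr by auto
  ultimately obtain m where m: "m \<in> K" "a = m \<otimes> u" "b = m \<otimes> v"
    using proportional_pair[OF KU(1,2) K(1,2)] by blast
  then have "\<mu> = m" using eq_scalar[OF _ KU(1,2) nz \<mu>] ab by simp
  then show "\<mu> \<in> K" using m(1) by simp
qed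

text \<open>The case of dependence over \<open>K\<close> but not over \<open>F\<close>. The
  hypothesis is applied not to the given pair but to \<open>(u, v)\<close> and its image
  \<open>(a, b)\<close> under \<open>\<mu>\<close>.\<close>

lemma S_gamma_inter_subset_F:
  assumes hyp: "\<And>w w'. \<lbrakk>w \<in> U; w' \<in> U; lin_indpt_pair L F K w w'\<rbrakk>
        \<Longrightarrow> S_plain L K U w \<inter> S_plain L K U w' = F"
    and w: "(u, v) \<in> U" "(u', v') \<in> U" "lin_indpt_pair L F K (u, v) (u', v')"
    and det: "u \<otimes> v' = v \<otimes> u'"
  shows "S_gamma L K U \<gamma> (u, v) \<inter> S_gamma L K U \<gamma> (u', v') \<subseteq> F"
proof
  fix \<mu> assume "\<mu> \<in> S_gamma L K U \<gamma> (u, v) \<inter> S_gamma L K U \<gamma> (u', v')"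
  then obtain a b c d where U: "(a, b) \<in> U" "(c, d) \<in> U"
    and K: "a \<in> K" "b \<in> K" "c \<in> K" "d \<in> K" and \<mu>: "\<mu> \<in> carrier L"
    and ab: "\<mu> \<otimes> (u \<oplus> v \<otimes> \<gamma>) = a \<oplus> b \<otimes> \<gamma>"
    and cd: "\<mu> \<otimes> (u' \<oplus> v' \<otimes> \<gamma>) = c \<oplus> d \<otimes> \<gamma>"
    by (elim IntE S_gammaE)
  note KU = U_closed[OF w(1)] U_closed[OF w(2)]
  note carr = K[THEN K_closed] KU[THEN K_closed]
  have nz: "(u, v) \<noteq> (\<zero>, \<zero>)" and indep: "\<And>t. t \<in> F \<Longrightarrow> (u', v') \<noteq> (t \<otimes> u, t \<otimes> v)"
    using w(3) lin_indpt_pair_iff[OF KU] by auto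
  obtain m where m: "m \<in> K" "u' = m \<otimes> u" "v' = m \<otimes> v"
    using proportional_pair[OF KU nz] det carr m_comm by metis
  have "c \<oplus> d \<otimes> \<gamma> = m \<otimes> (a \<oplus> b \<otimes> \<gamma>)"
    unfolding cd[symmetric] ab[symmetric] m(2,3) using \<mu> m(1)[THEN K_closed] carr \<gamma>_closed by algebra
  then have "(c, d) = (m \<otimes> a, m \<otimes> b)"
    using smult_linear[OF m(1) K(1,2)] linear_eq_iff K m(1) subringE(6)[OF subring_K] by auto
  \<comment> \<open>Multiplication by \<open>m\<close> sends \<open>(u, v)\<close> to
    \<open>(u', v')\<close> and \<open>(a, b)\<close> to \<open>(c, d)\<close>, both in
    \<open>U\<close>.\<close>
  then have "m \<in> S_plain L K U (u, v) \<inter> S_plain L K U (a, b)"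
    using w U m unfolding S_plain_def by auto
  moreover have "m \<notin> F" using indep m(2,3) by blast
  ultimately have "\<not> lin_indpt_pair L F K (u, v) (a, b)"
    using hyp[OF w(1) U(1)] by blast
  then obtain t where t: "t \<in> F" "a = t \<otimes> u" "b = t \<otimes> v"
    using lin_indpt_pair_iff[OF KU(1,2) K(1,2)] nz by auto
  have "\<mu> = t"
    using eq_scalar[OF _ KU(1,2) nz \<mu>, of t] ab t F_subset_K by auto
  then show "\<mu> \<in> F" using t by simp
qed

lemma Sidon_space_property_iff:
  "Sidon_space_property L F K U \<gamma> \<longleftrightarrow>
    (\<forall>w\<in>U. \<forall>w'\<in>U. lin_indpt_pair L F K w w' \<longrightarrow> S_plain L K U w \<inter> S_plain L K U w' = F)"
  (is "_ \<longleftrightarrow> ?plain")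
proof
  assume sidon: "Sidon_space_property L F K U \<gamma>"
  show ?plain
  proof (intro ballI impI)
    fix w w' assume w: "w \<in> U" "w' \<in> U" "lin_indpt_pair L F K w w'"
    then have "S_gamma L K U \<gamma> w \<inter> S_gamma L K U \<gamma> w' = F"
      using sidon unfolding Sidon_space_property_def by blast
    then show "S_plain L K U w \<inter> S_plain L K U w' = F"
      \<comment> \<open>Cutting down to \<open>K\<close> leaves \<open>F\<close> unchanged because
        \<open>F\<close> is contained in \<open>K\<close>.\<close>
      using S_plain_eq[of "fst w" "snd w"] S_plain_eq[of "fst w'" "snd w'"] w F_subset_K by auto
  qed
next
  assume plain: ?plain
  show "Sidon_space_property L F K U \<gamma>"
    unfolding Sidon_space_property_def
  proof (intro ballI impI)
    fix w w' assume w: "w \<in> U" "w' \<in> U" "lin_indpt_pair L F K w w'"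
    obtain u v u' v' where eq: "w = (u, v)" "w' = (u', v')" by (cases w, cases w')
    \<comment> \<open>The condition over \<open>K\<close> fixes the part inside \<open>K\<close> and
      already gives the inclusion of \<open>F\<close>; only the reverse inclusion remains.\<close>
    have inter: "S_gamma L K U \<gamma> w \<inter> S_gamma L K U \<gamma> w' \<inter> K = F"
      using plain w S_plain_eq unfolding eq by blast
    have "S_gamma L K U \<gamma> w \<inter> S_gamma L K U \<gamma> w' \<subseteq> F"
    proof (cases "u \<otimes> v' = v \<otimes> u'")
      case True
      then show ?thesis using S_gamma_inter_subset_F plain w unfolding eq by blast
    next
      case False
      then show ?thesis using S_gamma_inter_subset_K inter w unfolding eq by blast
    qed
    then show "S_gamma L K U \<gamma> w \<inter> S_gamma L K U \<gamma> w' = F" using inter by blast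
  qed
qed

end

theorem theorem3p4:
  fixes L :: "('a, 'b) ring_scheme" and F K :: "'a set" and U :: "('a \<times> 'a) set"
    and \<gamma> :: 'a and f :: "'a list" and q k :: nat
  assumes "primepow q" and "k > 0"
    and "field L"
    and "subfield F L" and "card F = q"
    and "subfield K L" and "card K = q ^ k" and "F \<subseteq> K"
    and "subspace (L\<lparr>carrier := F\<rparr>) U (plane L K)"
    and "f \<in> carrier (univ_poly L K)" and "pirreducible\<^bsub>L\<^esub> K f" and "degree f > 2"
    and "\<gamma> \<in> carrier L" and "ring.eval L f \<gamma> = \<zero>\<^bsub>L\<^esub>"
  shows "Sidon_space_property L F K U \<gamma> \<longleftrightarrow>
    (\<forall>w\<in>U. \<forall>w'\<in>U. lin_indpt_pair L F K w w' \<longrightarrow> S_plain L K U w \<inter> S_plain L K U w' = F)"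
proof -
  interpret field L by fact
  interpret degree_gt_two_generator L F K U \<gamma>
  proof (intro degree_gt_two_generator.intro degree_gt_two_generator_axioms.intro)
    fix a b c assume "a \<in> K" "b \<in> K" "c \<in> K"
      "a \<oplus>\<^bsub>L\<^esub> b \<otimes>\<^bsub>L\<^esub> \<gamma> \<oplus>\<^bsub>L\<^esub> c \<otimes>\<^bsub>L\<^esub> (\<gamma> \<otimes>\<^bsub>L\<^esub> \<gamma>) = \<zero>\<^bsub>L\<^esub>"
    then show "a = \<zero>\<^bsub>L\<^esub> \<and> b = \<zero>\<^bsub>L\<^esub> \<and> c = \<zero>\<^bsub>L\<^esub>"
      by (rule quadratic_independent[OF assms(6,13,10,11,14,12)])
  qed fact+
  show ?thesis by (rule Sidon_space_property_iff)
qed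

end
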